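(* Let $S,T,P:M\to L$ be linear maps such that $S+T+P=0$. If at least one of the six pairs $$(S,T),\quad (-T,-S),\quad (T,P),\quad (-P,-T),\quad (P,S),\quad (-S,-P)$$ is a Moufang-Mal'tsev pair, then all six of these pairs are Moufang-Mal'tsev pairs.
   Context: Let $\mathbb F$ be a field of characteristic different from $2$ and $3$ (e.g. $\mathbb R$ or $\mathbb C$). Let $M$ be an anti-commutative (not necessarily associative) algebra over $\mathbb F$ and let $L$ be a Lie algebra over $\mathbb F$; both products are denoted $[\cdot,\cdot]$. For a linear map $A:M\to L$ write $A_x=A(x)$. A pair $(A,B)$ of linear maps $A,B:M\to L$ is called a Moufang-Mal'tsev pair if for all $x,y\in M$ $$[A_x,A_y]=A_{[x,y]}-2[A_x,B_y],\qquad [B_x,B_y]=B_{[y,x]}-2[B_x,A_y].$$ *)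

theory Defs
  imports Complex_Main
begin

text \<open>Algebras over a field, with no associativity, unit or dimension requirement. The scalar
  multiplication is a locale parameter because the classes \<^class>\<open>real_vector\<close> etc. fix
  the field to be the reals. No characteristic is assumed here, so the Lie bracket is required
  to be alternating and not merely anti-commutative.\<close>

locale nonassoc_algebra = vector_space scale
  for scale :: "'k::field \<Rightarrow> 'a::ab_group_add \<Rightarrow> 'a" +
  fixes bracket :: "'a \<Rightarrow> 'a \<Rightarrow> 'a"
  assumes bracket_linear_left: "Vector_Spaces.linear scale scale (\<lambda>x. bracket x y)"
    and bracket_linear_right: "Vector_Spaces.linear scale scale (\<lambda>y. bracket x y)"

locale anticommutative_algebra = nonassoc_algebra +
  assumes anticommute: "bracket x y = - bracket y x"

locale lie_algebra = nonassoc_algebra +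
  assumes alternating: "bracket x x = 0"
    and jacobi: "bracket x (bracket y z) + bracket y (bracket z x) + bracket z (bracket x y) = 0"

definition moufang_maltsev_pair ::
  "('k::field \<Rightarrow> 'm::ab_group_add \<Rightarrow> 'm) \<Rightarrow> ('m \<Rightarrow> 'm \<Rightarrow> 'm) \<Rightarrow>
   ('k \<Rightarrow> 'l::ab_group_add \<Rightarrow> 'l) \<Rightarrow> ('l \<Rightarrow> 'l \<Rightarrow> 'l) \<Rightarrow>
   ('m \<Rightarrow> 'l) \<Rightarrow> ('m \<Rightarrow> 'l) \<Rightarrow> bool" where
  "moufang_maltsev_pair scaleM bracketM scaleL bracketL A B \<longleftrightarrow>
     Vector_Spaces.linear scaleM scaleL A \<and> Vector_Spaces.linear scaleM scaleL B \<and>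
     (\<forall>x y. bracketL (A x) (A y) = A (bracketM x y) - scaleL 2 (bracketL (A x) (B y)) \<and>
            bracketL (B x) (B y) = B (bracketM y x) - scaleL 2 (bracketL (B x) (A y)))"

end

theory Submission
  imports Defs
begin

text \<open>The six pairs form one orbit of \<open>S\<^sub>3\<close>, generated by the reversal
  \<open>(A, B) \<mapsto> (-B, -A)\<close> and the rotation \<open>(A, B) \<mapsto> (B, C)\<close>, where \<open>A + B + C = 0\<close>.
  Both preserve Moufang-Mal'tsev pairs.

  The reversal only exchanges the two defining identities, since \<open>-A[y,x] = A[x,y]\<close>.
  For the rotation, put \<open>C = -A - B\<close>. The term \<open>-2[B\<^sub>x, C\<^sub>y]\<close> in the first identity of
  \<open>(B, C)\<close> contributes \<open>2[B\<^sub>x, B\<^sub>y]\<close>, which turns that identity into the second one of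
  \<open>(A, B)\<close>. In the second identity of \<open>(B, C)\<close>, substituting the values of \<open>A[x,y]\<close> and
  \<open>B[x,y]\<close> given by \<open>(A, B)\<close> leaves \<open>3[A\<^sub>x, B\<^sub>y] = 3[B\<^sub>x, A\<^sub>y]\<close>. So the heart of the
  matter is the symmetry \<open>[A\<^sub>x, B\<^sub>y] = [B\<^sub>x, A\<^sub>y]\<close> of
  \<open>moufang_maltsev_pair_mixed_bracket\<close>, where 2 has to be cancelled.\<close>

lemma two_neq_zero_if_CHAR_neq_2:
  assumes "CHAR('k::field) \<noteq> 2"
  shows "(2::'k) \<noteq> 0"
proof
  assume "(2::'k) = 0"
  then have "of_nat 2 = (0::'k)" by simp
  then have "CHAR('k) dvd 2" by (simp only: of_nat_eq_0_iff_char_dvd)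
  then have "CHAR('k) = 1 \<or> CHAR('k) = 2"
    using dvd_imp_le[of "CHAR('k)" 2] by (auto simp: numeral_2_eq_2 le_Suc_eq)
  then show False using assms CHAR_not_1 by auto
qed

context nonassoc_algebra
begin

lemma bracket_add_left: "bracket (x + y) z = bracket x z + bracket y z"
  and bracket_add_right: "bracket z (x + y) = bracket z x + bracket z y"
  and bracket_minus_left: "bracket (- x) z = - bracket x z"
  and bracket_minus_right: "bracket z (- x) = - bracket z x"
proof -
  interpret l: Vector_Spaces.linear scale scale "\<lambda>x. bracket x z" by (rule bracket_linear_left)
  interpret r: Vector_Spaces.linear scale scale "bracket z" by (rule bracket_linear_right)
  show "bracket (x + y) z = bracket x z + bracket y z" by (rule l.add)
  show "bracket z (x + y) = bracket z x + bracket z y" by (rule r.add)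
  show "bracket (- x) z = - bracket x z" by (rule l.neg)
  show "bracket z (- x) = - bracket z x" by (rule r.neg)
qed

lemma scale_two: "scale 2 x = x + x"
  using scale_left_distrib[of 1 1 x] by simp

end

lemma (in lie_algebra) bracket_skew: "bracket x y = - bracket y x"
proof -
  have "bracket x y + bracket y x = bracket (x + y) (x + y)"
    by (simp only: bracket_add_left bracket_add_right) (simp add: alternating)
  then show ?thesis
    by (simp only: alternating eq_neg_iff_add_eq_0)
qed

lemma moufang_maltsev_pair_reverse:
  assumes M: "anticommutative_algebra scaleM bracketM"
    and L: "lie_algebra scaleL bracketL"
    and pair: "moufang_maltsev_pair scaleM bracketM scaleL bracketL A B"
  shows "moufang_maltsev_pair scaleM bracketM scaleL bracketL (\<lambda>x. - B x) (\<lambda>x. - A x)"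
proof -
  interpret M: anticommutative_algebra scaleM bracketM by (rule M)
  interpret L: lie_algebra scaleL bracketL by (rule L)
  interpret VP: vector_space_pair scaleM scaleL ..
  have lin: "Vector_Spaces.linear scaleM scaleL A" "Vector_Spaces.linear scaleM scaleL B"
    and id: "\<And>x y. bracketL (A x) (A y) = A (bracketM x y) - scaleL 2 (bracketL (A x) (B y))"
    "\<And>x y. bracketL (B x) (B y) = B (bracketM y x) - scaleL 2 (bracketL (B x) (A y))"
    using pair by (auto simp: moufang_maltsev_pair_def)
  interpret A: Vector_Spaces.linear scaleM scaleL A by (rule lin)
  interpret B: Vector_Spaces.linear scaleM scaleL B by (rule lin)
  have skew: "- A (bracketM y x) = A (bracketM x y)" "- B (bracketM x y) = B (bracketM y x)" for x y
    by (simp_all flip: A.neg B.neg M.anticommute)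
  show ?thesis
    unfolding moufang_maltsev_pair_def
    using lin by (auto simp: VP.linear_compose_neg L.bracket_minus_left L.bracket_minus_right
        id skew)
qed

lemma moufang_maltsev_pair_reverse_iff:
  assumes "anticommutative_algebra scaleM bracketM"
    and "lie_algebra scaleL bracketL"
  shows "moufang_maltsev_pair scaleM bracketM scaleL bracketL (\<lambda>x. - B x) (\<lambda>x. - A x) \<longleftrightarrow>
    moufang_maltsev_pair scaleM bracketM scaleL bracketL A B"
  using moufang_maltsev_pair_reverse[OF assms, of A B]
    moufang_maltsev_pair_reverse[OF assms, of "\<lambda>x. - B x" "\<lambda>x. - A x"] by auto

text \<open>Both \<open>[A\<^sub>x, A\<^sub>y]\<close> and \<open>A[x,y]\<close> change sign when \<open>x\<close> and \<open>y\<close> are exchanged, so by the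
  first identity \<open>2[A\<^sub>x, B\<^sub>y]\<close> does too: \<open>2[A\<^sub>x, B\<^sub>y] = -2[A\<^sub>y, B\<^sub>x] = 2[B\<^sub>x, A\<^sub>y]\<close>.\<close>

lemma moufang_maltsev_pair_mixed_bracket:
  fixes scaleL :: "'k::field \<Rightarrow> 'l::ab_group_add \<Rightarrow> 'l"
  assumes two: "(2::'k) \<noteq> 0"
    and M: "anticommutative_algebra scaleM bracketM"
    and L: "lie_algebra scaleL bracketL"
    and pair: "moufang_maltsev_pair scaleM bracketM scaleL bracketL A B"
  shows "bracketL (A x) (B y) = bracketL (B x) (A y)"
proof -
  interpret M: anticommutative_algebra scaleM bracketM by (rule M)
  interpret L: lie_algebra scaleL bracketL by (rule L)
  interpret A: Vector_Spaces.linear scaleM scaleL A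
    using pair by (simp add: moufang_maltsev_pair_def)
  have two_AB: "scaleL 2 (bracketL (A u) (B v)) = A (bracketM u v) - bracketL (A u) (A v)" for u v
    using pair by (simp add: moufang_maltsev_pair_def)
  have "scaleL 2 (bracketL (B x) (A y)) = - scaleL 2 (bracketL (A y) (B x))"
    by (simp add: L.bracket_skew[of "B x"])
  also have "\<dots> = - A (bracketM y x) + bracketL (A y) (A x)"
    by (simp add: two_AB)
  also have "\<dots> = A (bracketM x y) - bracketL (A x) (A y)"
    by (simp add: M.anticommute[of x y] L.bracket_skew[of "A x" "A y"] A.neg)
  also have "\<dots> = scaleL 2 (bracketL (A x) (B y))"
    by (simp add: two_AB)
  finally show ?thesis
    using two by simp
qed

lemma moufang_maltsev_pair_rotate:
  fixes scaleL :: "'k::field \<Rightarrow> 'l::ab_group_add \<Rightarrow> 'l"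
  assumes two: "(2::'k) \<noteq> 0"
    and M: "anticommutative_algebra scaleM bracketM"
    and L: "lie_algebra scaleL bracketL"
    and lin_C: "Vector_Spaces.linear scaleM scaleL C"
    and sum_zero: "\<And>x. A x + B x + C x = 0"
    and pair: "moufang_maltsev_pair scaleM bracketM scaleL bracketL A B"
  shows "moufang_maltsev_pair scaleM bracketM scaleL bracketL B C"
proof -
  interpret M: anticommutative_algebra scaleM bracketM by (rule M)
  interpret L: lie_algebra scaleL bracketL by (rule L)
  have lin_B: "Vector_Spaces.linear scaleM scaleL B"
    using pair by (simp add: moufang_maltsev_pair_def)
  interpret A: Vector_Spaces.linear scaleM scaleL A
    using pair by (simp add: moufang_maltsev_pair_def)
  interpret B: Vector_Spaces.linear scaleM scaleL B by (rule lin_B)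
  have C: "C x = - A x + - B x" for x
    using sum_zero[of x] by (simp add: eq_neg_iff_add_eq_0 algebra_simps)
  have A_bracket: "A (bracketM x y) =
      bracketL (A x) (A y) + (bracketL (A x) (B y) + bracketL (A x) (B y))" for x y
    using pair by (simp add: moufang_maltsev_pair_def L.scale_two)
  have B_bracket': "B (bracketM y x) =
      bracketL (B x) (B y) + (bracketL (B x) (A y) + bracketL (B x) (A y))" for x y
    using pair by (simp add: moufang_maltsev_pair_def L.scale_two)
  have A_skew: "A (bracketM y x) = - A (bracketM x y)"
    and B_skew: "B (bracketM y x) = - B (bracketM x y)" for x y
    by (simp_all flip: A.neg B.neg M.anticommute)
  have B_bracket: "B (bracketM x y) =
      - (bracketL (B x) (B y) + (bracketL (B x) (A y) + bracketL (B x) (A y)))" for x y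
    by (simp only: B_bracket'[symmetric] B_skew[of x y] minus_minus)
  have mixed: "bracketL (A x) (B y) = bracketL (B x) (A y)" for x y
    by (rule moufang_maltsev_pair_mixed_bracket[OF two M L pair])
  note expand = L.bracket_add_left L.bracket_add_right L.bracket_minus_left L.bracket_minus_right
    L.scale_two
  have "bracketL (B x) (B y) = B (bracketM x y) - scaleL 2 (bracketL (B x) (C y))" for x y
    unfolding C expand by (simp add: B_bracket)
  \<comment> \<open>The two sides differ by a multiple of \<open>[A\<^sub>x, B\<^sub>y] - [B\<^sub>x, A\<^sub>y]\<close>.\<close>
  moreover have "bracketL (C x) (C y) = C (bracketM y x) - scaleL 2 (bracketL (C x) (B y))" for x y
  proof -
    have "C (bracketM y x) = A (bracketM x y) + B (bracketM x y)"
      by (simp add: C A_skew[of x y] B_skew[of x y])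
    then show ?thesis
      unfolding C[of x] C[of y] expand by (simp add: A_bracket B_bracket mixed)
  qed
  ultimately show ?thesis
    using lin_B lin_C by (simp add: moufang_maltsev_pair_def)
qed

theorem lemma3p2:
  fixes scaleM :: "'k::field \<Rightarrow> 'm::ab_group_add \<Rightarrow> 'm"
    and bracketM :: "'m \<Rightarrow> 'm \<Rightarrow> 'm"
    and scaleL :: "'k \<Rightarrow> 'l::ab_group_add \<Rightarrow> 'l"
    and bracketL :: "'l \<Rightarrow> 'l \<Rightarrow> 'l"
    and S T P :: "'m \<Rightarrow> 'l"
  assumes "CHAR('k) \<noteq> 2" and "CHAR('k) \<noteq> 3"
    and "anticommutative_algebra scaleM bracketM"
    and "lie_algebra scaleL bracketL"
    and "Vector_Spaces.linear scaleM scaleL S"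
    and "Vector_Spaces.linear scaleM scaleL T"
    and "Vector_Spaces.linear scaleM scaleL P"
    and "\<forall>x. S x + T x + P x = 0"
    and "\<exists>(A, B) \<in> {(S, T), (\<lambda>x. - T x, \<lambda>x. - S x),
                      (T, P), (\<lambda>x. - P x, \<lambda>x. - T x),
                      (P, S), (\<lambda>x. - S x, \<lambda>x. - P x)}.
           moufang_maltsev_pair scaleM bracketM scaleL bracketL A B"
  shows "\<forall>(A, B) \<in> {(S, T), (\<lambda>x. - T x, \<lambda>x. - S x),
                      (T, P), (\<lambda>x. - P x, \<lambda>x. - T x),
                      (P, S), (\<lambda>x. - S x, \<lambda>x. - P x)}.
           moufang_maltsev_pair scaleM bracketM scaleL bracketL A B"
proof -
  let ?mm = "moufang_maltsev_pair scaleM bracketM scaleL bracketL"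
  note two = two_neq_zero_if_CHAR_neq_2[OF assms(1)]
  note rotate = moufang_maltsev_pair_rotate[OF two assms(3,4)]
  note reverse_iff = moufang_maltsev_pair_reverse_iff[OF assms(3,4)]
  have "?mm S T \<Longrightarrow> ?mm T P"
    by (rule rotate[of P S T]) (use assms(7,8) in auto)
  moreover have "?mm T P \<Longrightarrow> ?mm P S"
    by (rule rotate[of S T P]) (use assms(5,8) in \<open>auto simp: ac_simps\<close>)
  moreover have "?mm P S \<Longrightarrow> ?mm S T"
    by (rule rotate[of T P S]) (use assms(6,8) in \<open>auto simp: ac_simps\<close>)
  moreover have "?mm S T \<or> ?mm T P \<or> ?mm P S"
    using assms(9) by (auto simp: reverse_iff)
  ultimately show ?thesis
    by (auto simp: reverse_iff)
qed

end
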